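(* (a) For every $B$ there is a flip sequence $(3,a_2,a_3,a_4)$ with $a_4>B$; but there is a constant $B_4$ such that every flip sequence $(a_1,a_2,a_3,a_4)$ with $a_1\le 2$ has $a_4\le B_4$. (b) For every $B$ there is a flip sequence $(2,a_2,a_3,a_4,a_5)$ with $a_5>B$; but there is a constant $B_5$ such that every flip sequence $(1,a_2,a_3,a_4,a_5)$ has $a_5\le B_5$. (c) For every $B$ there is a flip sequence $(1,a_2,a_3,a_4,a_5,a_6)$ with $a_6>B$.
   Context: A $t$-edge-colored graph is a simple graph each of whose edges receives one of the colors $1,\dots,t$. For $\vec r,\vec c\in\mathbb{N}^t$ it is $(\vec r,\vec c)$-triangle-regular if every vertex $v$ is incident to exactly $\vec r[i]$ edges of color $i$ and $N(v)$ induces exactly $\vec c[i]$ edges of color $i$, for each $i$. It is a flip graph if $\vec r[i]<\vec r[j]$ and $\vec r[i]+\vec c[i]>\vec r[j]+\vec c[j]$ for all $1\le i<j\le t$ (equivalently: every vertex has strictly more incident edges of color $j$ than of color $i$, while its closed neighborhood $N(v)\cup\{v\}$ induces strictly more edges of color $i$ than of color $j$). A sequence $(a_1,\dots,a_t)\in\mathbb{N}^t$ is a flip sequence if there exist $\vec c\in\mathbb{N}^t$ and a finite $((a_1,\dots,a_t),\vec c)$-triangle-regular $t$-edge-colored graph that is a flip graph. *)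

theory Defs imports Main begin

text \<open>
  A simple graph is a vertex set together with a set of two-element subsets of it.
  The empty graph is excluded: it is vacuously triangle-regular for all parameters,
  so it would make every admissible choice of parameters a flip sequence.
\<close>

locale edge_colored_graph =
  fixes t :: nat and V :: "'v set" and E :: "'v set set" and col :: "'v set \<Rightarrow> nat"
  assumes vertices_nonempty: "V \<noteq> {}"
    and edges: "\<And>e. e \<in> E \<Longrightarrow> e \<subseteq> V \<and> card e = 2"
    and colors: "\<And>e. e \<in> E \<Longrightarrow> col e \<in> {1..t}"

definition neighborhood :: "'v set set \<Rightarrow> 'v \<Rightarrow> 'v set" where
  "neighborhood E v = {u. {v, u} \<in> E}"

definition incident_edges :: "'v set set \<Rightarrow> ('v set \<Rightarrow> nat) \<Rightarrow> nat \<Rightarrow> 'v \<Rightarrow> 'v set set" where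
  "incident_edges E col i v = {e \<in> E. v \<in> e \<and> col e = i}"

definition induced_edges :: "'v set set \<Rightarrow> ('v set \<Rightarrow> nat) \<Rightarrow> nat \<Rightarrow> 'v set \<Rightarrow> 'v set set" where
  "induced_edges E col i S = {e \<in> E. e \<subseteq> S \<and> col e = i}"

text \<open>
  Vectors in \<open>\<nat>\<^sup>t\<close> are functions of which only the values on \<open>{1..t}\<close> are used.
\<close>

locale triangle_regular_graph = edge_colored_graph t V E col
  for t :: nat and V :: "'v set" and E :: "'v set set" and col :: "'v set \<Rightarrow> nat" +
  fixes r c :: "nat \<Rightarrow> nat"
  assumes finite_vertices: "finite V"
    and incident: "\<And>v i. v \<in> V \<Longrightarrow> i \<in> {1..t} \<Longrightarrow> card (incident_edges E col i v) = r i"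
    and induced: "\<And>v i. v \<in> V \<Longrightarrow> i \<in> {1..t} \<Longrightarrow>
      card (induced_edges E col i (neighborhood E v)) = c i"

locale flip_graph = triangle_regular_graph t V E col r c
  for t :: nat and V :: "'v set" and E :: "'v set set" and col :: "'v set \<Rightarrow> nat"
    and r c :: "nat \<Rightarrow> nat" +
  assumes degrees_increase: "\<And>i j. 1 \<le> i \<Longrightarrow> i < j \<Longrightarrow> j \<le> t \<Longrightarrow> r i < r j"
    and closed_counts_decrease:
      "\<And>i j. 1 \<le> i \<Longrightarrow> i < j \<Longrightarrow> j \<le> t \<Longrightarrow> r i + c i > r j + c j"

text \<open>
  The graphs are finite, so up to isomorphism their vertices are natural numbers.
  List positions start at 0 while colors start at 1, hence the index shift.
\<close>

definition flip_sequence :: "nat list \<Rightarrow> bool" where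
  "flip_sequence a \<longleftrightarrow>
     (\<exists>(c :: nat \<Rightarrow> nat) (V :: nat set) E col.
        flip_graph (length a) V E col (\<lambda>i. a ! (i - 1)) c)"

end

theory Submission imports Defs begin

text \<open>
  Say that two edges at a common vertex form a corner, closed if they lie in a triangle. Counting
  over all vertices, \<open>c 1\<close> is governed by the closed corners that contain a color-1 edge, and so is
  a lower bound for each \<open>c j\<close> with \<open>j \<ge> 2\<close>: a corner of colors 1 and \<open>j\<close> adds up to 1/2 to \<open>c 1\<close> and
  at least about 1 to \<open>c j\<close>. There are at most \<open>r 1 * r j\<close> such corners at a vertex, and
  \<open>c 1 - c j \<ge> r j - r 1 + (j - 1)\<close> along a flip sequence. Averaging over the last two of four colors,
  or over all the colors 2 to 5, gives a contradiction, so there are no flip sequences at all for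
  the parameters where a bound is claimed.

  Conversely, blow up every vertex of a regular edge-colored bipartite graph to a clique of size
  \<open>m + 1\<close> in color 1, replacing an edge either by all edges between the two cliques or by a perfect
  matching. The full joins attain equality in the estimate above, and the matchings change the degrees
  without changing the \<open>c j\<close>. With large, nearly equal degrees this is a flip graph whenever
  \<open>2 * (m + 1) < (t - 1) * m\<close>, which holds for \<open>(m, t) = (3, 4), (2, 5), (1, 6)\<close>.
\<close>

section \<open>Edge colors as a symmetric function on pairs of vertices\<close>

definition edge_color :: "'v set set \<Rightarrow> ('v set \<Rightarrow> nat) \<Rightarrow> 'v \<Rightarrow> 'v \<Rightarrow> nat" where
  "edge_color E col u v = (if {u, v} \<in> E then col {u, v} else 0)"

context edge_colored_graph
begin

abbreviation "ec \<equiv> edge_color E col"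

lemma ec_sym: "ec u v = ec v u"
  by (simp add: edge_color_def insert_commute)

lemma ec_refl [simp]: "ec v v = 0"
  using edges[of "{v}"] by (auto simp: edge_color_def)

text \<open>Colors start at 1, which leaves 0 free to encode non-adjacency.\<close>

lemma edge_iff_ec: "{u, v} \<in> E \<longleftrightarrow> ec u v \<noteq> 0"
  using colors by (force simp: edge_color_def)

lemma ec_le: "ec u v \<le> t"
  using colors[of "{u, v}"] by (auto simp: edge_color_def)

lemma ec_vertices: "ec u v \<noteq> 0 \<Longrightarrow> u \<in> V \<and> v \<in> V"
  using edges[of "{u, v}"] edge_iff_ec[of u v] by auto

lemma card_incident_edges:
  assumes "i \<noteq> 0"
  shows "card (incident_edges E col i v) = card {u. ec v u = i}"
proof -
  have "bij_betw (\<lambda>u. {v, u}) {u. ec v u = i} (incident_edges E col i v)"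
  proof (rule bij_betw_imageI)
    show "inj_on (\<lambda>u. {v, u}) {u. ec v u = i}"
      by (auto simp: inj_on_def doubleton_eq_iff)
    show "(\<lambda>u. {v, u}) ` {u. ec v u = i} = incident_edges E col i v"
    proof (intro equalityI subsetI)
      fix e assume "e \<in> (\<lambda>u. {v, u}) ` {u. ec v u = i}"
      then show "e \<in> incident_edges E col i v"
        using assms by (auto simp: incident_edges_def edge_color_def split: if_splits)
    next
      fix e assume e: "e \<in> incident_edges E col i v"
      then have "card e = 2" "v \<in> e"
        using edges by (auto simp: incident_edges_def)
      then obtain u where "e = {v, u}"
        by (auto simp: card_2_iff)
      then show "e \<in> (\<lambda>u. {v, u}) ` {u. ec v u = i}"
        using e by (auto simp: incident_edges_def edge_color_def)
    qed
  qed
  then show ?thesis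
    by (simp add: bij_betw_same_card)
qed

text \<open>An edge \<open>{u, w}\<close> arises from the two ordered pairs \<open>(u, w)\<close>
  and \<open>(w, u)\<close>. Ordered pairs make later counts plain sums over \<open>V\<close>, at
  the cost of this factor 2.\<close>

lemma card_induced_edges:
  assumes "i \<noteq> 0" and "finite V"
  shows "card {(u, w). ec v u \<noteq> 0 \<and> ec v w \<noteq> 0 \<and> ec u w = i}
    = 2 * card (induced_edges E col i (neighborhood E v))" (is "card ?P = 2 * card ?I")
proof -
  have "E \<subseteq> Pow V"
    using edges by auto
  then have "finite ?I"
    using assms(2) by (auto simp: induced_edges_def intro: finite_subset[of _ "Pow V"])
  have color_iff: "ec u w = i \<longleftrightarrow> {u, w} \<in> E \<and> col {u, w} = i" for u w
    using assms(1) by (auto simp: edge_color_def)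
  have P: "?P = (\<Union>e\<in>?I. {(u, w). {u, w} = e})"
    unfolding induced_edges_def neighborhood_def edge_iff_ec[symmetric] color_iff by auto
  have two: "finite {(u, w). {u, w} = e} \<and> card {(u, w). {u, w} = e} = 2" if "e \<in> ?I" for e
  proof -
    have "card e = 2"
      using that edges by (auto simp: induced_edges_def)
    then obtain a b where "e = {a, b}" "a \<noteq> b"
      by (auto simp: card_2_iff)
    then have "{(u, w). {u, w} = e} = {(a, b), (b, a)}"
      by (auto simp: doubleton_eq_iff)
    then show ?thesis
      using \<open>a \<noteq> b\<close> by simp
  qed
  have "card ?P = (\<Sum>e\<in>?I. card {(u, w). {u, w} = e})"
    unfolding P using \<open>finite ?I\<close> two by (intro card_UN_disjoint) auto
  also have "\<dots> = 2 * card ?I"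
    using two by simp
  finally show ?thesis .
qed

end


section \<open>Counting triangles\<close>

context triangle_regular_graph
begin

text \<open>Ordered triples are counted, so the value is invariant under all permutations of the
  three colors. Integers are used because counts get subtracted later.\<close>

definition triangles :: "nat \<Rightarrow> nat \<Rightarrow> nat \<Rightarrow> int" where
  "triangles i j k = (\<Sum>v\<in>V. \<Sum>u\<in>V. \<Sum>w\<in>V. of_bool (ec v u = i \<and> ec v w = j \<and> ec u w = k))"

definition closed_corners :: "nat \<Rightarrow> nat \<Rightarrow> int" where
  "closed_corners i j = (\<Sum>k=1..t. triangles i j k)"

lemma triangles_nonneg: "0 \<le> triangles i j k"
  by (simp add: triangles_def sum_nonneg)

lemma triangles_swap12: "triangles i j k = triangles j i k"
proof -
  have "triangles i j k = (\<Sum>v\<in>V. \<Sum>w\<in>V. \<Sum>u\<in>V. of_bool (ec v u = i \<and> ec v w = j \<and> ec u w = k))"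
    unfolding triangles_def by (rule sum.cong[OF refl], rule sum.swap)
  also have "\<dots> = triangles j i k"
    unfolding triangles_def by (intro sum.cong refl arg_cong[of _ _ of_bool]) (auto simp: ec_sym)
  finally show ?thesis .
qed

lemma triangles_swap23: "triangles i j k = triangles i k j"
proof -
  have "triangles i j k = (\<Sum>u\<in>V. \<Sum>v\<in>V. \<Sum>w\<in>V. of_bool (ec v u = i \<and> ec v w = j \<and> ec u w = k))"
    unfolding triangles_def by (rule sum.swap)
  also have "\<dots> = triangles i k j"
    unfolding triangles_def by (intro sum.cong refl arg_cong[of _ _ of_bool]) (auto simp: ec_sym)
  finally show ?thesis .
qed

lemma degree_sum:
  assumes "v \<in> V" "i \<in> {1..t}"
  shows "(\<Sum>u\<in>V. of_bool (ec v u = i)) = int (r i)"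
proof -
  have "u \<in> V" if "ec v u = i" for u
    using that assms(2) ec_vertices[of v u] by simp
  then have "{u. ec v u = i} = {u\<in>V. ec v u = i}"
    by auto
  then have "card {u\<in>V. ec v u = i} = r i"
    using incident[OF assms] card_incident_edges[of i v] assms(2) by simp
  then show ?thesis
    using finite_vertices by (simp add: sum.If_cases of_bool_def Int_def)
qed

lemma of_bool_ec: "of_bool (ec u w \<noteq> 0) = (\<Sum>k=1..t. of_bool (ec u w = k) :: int)"
proof -
  have "{1..t} \<inter> {k. ec u w = k} = (if ec u w \<noteq> 0 then {ec u w} else {})"
    using ec_le[of u w] by auto
  then show ?thesis
    by (simp add: of_bool_def sum.If_cases ec_le)
qed

lemma closed_corners_eq:
  "closed_corners i j =
    (\<Sum>v\<in>V. \<Sum>u\<in>V. \<Sum>w\<in>V. of_bool (ec v u = i) * of_bool (ec v w = j) * of_bool (ec u w \<noteq> 0))"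
proof -
  have "closed_corners i j = (\<Sum>v\<in>V. \<Sum>u\<in>V. \<Sum>w\<in>V. \<Sum>k=1..t.
      of_bool (ec v u = i \<and> ec v w = j \<and> ec u w = k))"
    unfolding closed_corners_def triangles_def
    by (simp only: sum.swap[of _ V "{1..t}"])
  also have "\<dots> = (\<Sum>v\<in>V. \<Sum>u\<in>V. \<Sum>w\<in>V.
      of_bool (ec v u = i) * of_bool (ec v w = j) * of_bool (ec u w \<noteq> 0))"
    unfolding of_bool_ec by (intro sum.cong refl) (simp add: of_bool_conj sum_distrib_left mult.assoc)
  finally show ?thesis .
qed

lemma closed_corners_le:
  assumes "i \<in> {1..t}" "j \<in> {1..t}"
  shows "closed_corners i j \<le> int (card V) * (int (r i) * int (r j))"
proof -
  have "closed_corners i j \<le> (\<Sum>v\<in>V. \<Sum>u\<in>V. \<Sum>w\<in>V. of_bool (ec v u = i) * of_bool (ec v w = j))"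
    unfolding closed_corners_eq by (intro sum_mono) auto
  also have "\<dots> = (\<Sum>v\<in>V. int (r i) * int (r j))"
    using assms by (intro sum.cong refl) (simp add: degree_sum flip: sum_product)
  finally show ?thesis
    by simp
qed

text \<open>The two ends of a closed corner are adjacent, hence distinct, so the \<open>r i\<close>
  diagonal pairs at each vertex can be subtracted.\<close>

lemma closed_corners_same_le:
  assumes "i \<in> {1..t}"
  shows "closed_corners i i \<le> int (card V) * (int (r i) * (int (r i) - 1))"
proof -
  have "closed_corners i i \<le> (\<Sum>v\<in>V. \<Sum>u\<in>V. \<Sum>w\<in>V.
      of_bool (ec v u = i) * of_bool (ec v w = i) - of_bool (ec v u = i) * of_bool (u = w))"
    unfolding closed_corners_eq by (intro sum_mono) auto
  also have "\<dots> = (\<Sum>v\<in>V. int (r i) * int (r i) - int (r i))"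
  proof (intro sum.cong refl)
    fix v assume v: "v \<in> V"
    have diag: "(\<Sum>w\<in>V. of_bool (u = w) :: int) = 1" if "u \<in> V" for u
      using that finite_vertices by (simp add: of_bool_def sum.delta')
    show "(\<Sum>u\<in>V. \<Sum>w\<in>V. of_bool (ec v u = i) * of_bool (ec v w = i)
        - of_bool (ec v u = i) * of_bool (u = w)) = int (r i) * int (r i) - int (r i)"
      using v assms diag
      by (simp add: sum_subtractf degree_sum flip: sum_product sum_distrib_left sum_distrib_right)
  qed
  finally show ?thesis
    by (simp add: algebra_simps)
qed

lemma induced_sum:
  assumes i: "i \<in> {1..t}"
  shows "2 * int (card V) * int (c i) = (\<Sum>j=1..t. \<Sum>k=1..t. triangles j k i)"
proof -
  have pairs: "2 * int (c i) = (\<Sum>u\<in>V. \<Sum>w\<in>V.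
      of_bool (ec u w = i) * (of_bool (ec v u \<noteq> 0) * of_bool (ec v w \<noteq> 0)))" if "v \<in> V" for v
  proof -
    have "{(u, w). ec v u \<noteq> 0 \<and> ec v w \<noteq> 0 \<and> ec u w = i} =
        (V \<times> V) \<inter> {(u, w). ec v u \<noteq> 0 \<and> ec v w \<noteq> 0 \<and> ec u w = i}"
      using ec_vertices by auto
    then have "int (card ((V \<times> V) \<inter> {(u, w). ec v u \<noteq> 0 \<and> ec v w \<noteq> 0 \<and> ec u w = i})) = 2 * int (c i)"
      using induced[OF that i] card_induced_edges[OF _ finite_vertices, of i v] i by simp
    moreover have "int (card ((V \<times> V) \<inter> {(u, w). ec v u \<noteq> 0 \<and> ec v w \<noteq> 0 \<and> ec u w = i})) =
        (\<Sum>p\<in>V \<times> V. case p of (u, w) \<Rightarrow> of_bool (ec u w = i) * (of_bool (ec v u \<noteq> 0) * of_bool (ec v w \<noteq> 0)))"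
      using finite_vertices
      by (subst sum_of_bool_eq[symmetric]) (auto simp del: sum_of_bool_eq intro!: sum.cong)
    ultimately show ?thesis
      by (simp add: sum.cartesian_product)
  qed
  have "2 * int (card V) * int (c i) = (\<Sum>v\<in>V. 2 * int (c i))"
    by simp
  also have "\<dots> = (\<Sum>v\<in>V. \<Sum>u\<in>V. \<Sum>w\<in>V.
      of_bool (ec u w = i) * (of_bool (ec v u \<noteq> 0) * of_bool (ec v w \<noteq> 0)))"
    using pairs by (intro sum.cong refl)
  also have "\<dots> = (\<Sum>v\<in>V. \<Sum>u\<in>V. \<Sum>w\<in>V. \<Sum>j=1..t. \<Sum>k=1..t.
      of_bool (ec v u = j \<and> ec v w = k \<and> ec u w = i))"
    unfolding of_bool_ec sum_product
    by (intro sum.cong refl) (simp add: of_bool_conj sum_distrib_left mult_ac)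
  also have "\<dots> = (\<Sum>j=1..t. \<Sum>k=1..t. triangles j k i)"
    unfolding triangles_def by (simp only: sum.swap[of _ V "{1..t}"])
  finally show ?thesis .
qed

text \<open>By symmetry, the color-1 edge opposite to \<open>v\<close> can be moved into the corner:
  triangles with a distinguished color-1 edge are the closed corners whose first edge has color
  1.\<close>

lemma induced_1:
  assumes "1 \<le> t"
  shows "2 * int (card V) * int (c 1) = (\<Sum>j=1..t. closed_corners 1 j)"
proof -
  have "triangles j k 1 = triangles 1 j k" for j k
    using triangles_swap12 triangles_swap23 by metis
  then show ?thesis
    using induced_sum[of 1] assms by (simp add: closed_corners_def)
qed

text \<open>Among the triangles whose edge opposite to \<open>v\<close> has color \<open>j\<close>,
  keep those with color 1 on at least one of the two edges at \<open>v\<close>. Inclusion-exclusion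
  subtracts those with color 1 on both.\<close>

lemma induced_ge:
  assumes "j \<in> {1..t}"
  shows "2 * closed_corners 1 j - triangles 1 1 j \<le> 2 * int (card V) * int (c j)"
proof -
  have split: "{1..t} = insert 1 {2..t}"
    using assms by auto
  have "0 \<le> (\<Sum>k=2..t. \<Sum>l=2..t. triangles k l j)"
    by (intro sum_nonneg triangles_nonneg)
  moreover have "closed_corners 1 j = triangles 1 1 j + (\<Sum>l=2..t. triangles 1 l j)"
    unfolding closed_corners_def split using triangles_swap23[of 1 j] by simp
  moreover have "(\<Sum>k=2..t. triangles k 1 j) = (\<Sum>l=2..t. triangles 1 l j)"
    by (intro sum.cong refl triangles_swap12)
  ultimately show ?thesis
    unfolding induced_sum[OF assms] unfolding split by (simp add: sum.distrib)
qed

end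

section \<open>Non-existence by averaging corner counts\<close>

context flip_graph
begin

lemma closed_counts_gap:
  assumes "1 \<le> i" "i \<le> j" "j \<le> t"
  shows "r j + c j + (j - i) \<le> r i + c i"
  using assms(2,3)
proof (induction j rule: dec_induct)
  case (step j)
  then show ?case
    using closed_counts_decrease[of j "Suc j"] assms(1) by simp
qed simp

lemma flip_inequality:
  assumes "j \<in> {1..t}"
  shows "2 * int (card V) * (int (r j) - int (r 1) + int j - 1)
    \<le> (\<Sum>k=1..t. closed_corners 1 k) - 2 * closed_corners 1 j + triangles 1 1 j"
proof -
  have "int (r j) - int (r 1) + int j - 1 \<le> int (c 1) - int (c j)"
    using closed_counts_gap[of 1 j] assms by auto
  then have "2 * int (card V) * (int (r j) - int (r 1) + int j - 1)
      \<le> 2 * int (card V) * (int (c 1) - int (c j))"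
    by (intro mult_left_mono) auto
  then show ?thesis
    using induced_ge[OF assms] induced_1 assms by (simp add: algebra_simps)
qed

lemma card_vertices_pos: "0 < card V"
  using vertices_nonempty finite_vertices by (simp add: card_gt_0_iff)

end

lemma no_flip_graph_4:
  assumes "flip_graph 4 V E col r c" and "r 1 \<le> 2"
  shows False
proof -
  interpret flip_graph 4 V E col r c by fact
  let ?n = "int (card V)"
  have iv: "{Suc 0..4} = {1, 2, 3, 4}"
    by auto
  \<comment> \<open>In the sum of the inequalities for colors 3 and 4, the corners of colors (1,3)
    and (1,4) cancel, so the right side no longer grows with \<open>r 3\<close> and
    \<open>r 4\<close>.\<close>
  have "2 * ?n * (int (r 3) - int (r 1) + 2) + 2 * ?n * (int (r 4) - int (r 1) + 3)
      \<le> 2 * closed_corners 1 1 + 2 * closed_corners 1 2 + triangles 1 1 3 + triangles 1 1 4"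
    using flip_inequality[of 3] flip_inequality[of 4] by (simp add: iv algebra_simps)
  also have "\<dots> \<le> 3 * closed_corners 1 1 + 2 * closed_corners 1 2"
    using triangles_nonneg[of 1 1 1] triangles_nonneg[of 1 1 2]
    by (simp add: closed_corners_def iv)
  also have "\<dots> \<le> 3 * (?n * (int (r 1) * (int (r 1) - 1))) + 2 * (?n * (int (r 1) * int (r 2)))"
    using closed_corners_same_le[of 1] closed_corners_le[of 1 2] by simp
  finally have "?n * (2 * (int (r 3) - int (r 1) + 2) + 2 * (int (r 4) - int (r 1) + 3))
      \<le> ?n * (3 * (int (r 1) * (int (r 1) - 1)) + 2 * (int (r 1) * int (r 2)))"
    by (simp add: algebra_simps)
  then have "2 * (int (r 3) - int (r 1) + 2) + 2 * (int (r 4) - int (r 1) + 3)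
      \<le> 3 * (int (r 1) * (int (r 1) - 1)) + 2 * (int (r 1) * int (r 2))"
    using card_vertices_pos by simp
  \<comment> \<open>For \<open>r 1 = 2\<close> the left side is at least \<open>4 * r 2 + 8\<close>,
    against \<open>4 * r 2 + 6\<close> on the right; smaller \<open>r 1\<close> leaves more
    room.\<close>
  moreover have "r 2 < r 3" "r 3 < r 4"
    by (simp_all add: degrees_increase)
  moreover have "r 1 = 0 \<or> r 1 = 1 \<or> r 1 = 2"
    using assms(2) by auto
  ultimately show False
    by auto
qed

lemma no_flip_graph_5:
  assumes "flip_graph 5 V E col r c" and "r 1 = 1"
  shows False
proof -
  interpret flip_graph 5 V E col r c by fact
  let ?n = "int (card V)"
  have iv: "{Suc 0..5} = {1, 2, 3, 4, 5}"
    by auto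
  \<comment> \<open>With one color-1 edge per vertex, no corner has both edges of color 1.\<close>
  have c11: "closed_corners 1 1 \<le> 0"
    using closed_corners_same_le[of 1] assms(2) by simp
  have "2 * ?n * int (r 2) + 2 * ?n * (int (r 3) + 1) + 2 * ?n * (int (r 4) + 2) + 2 * ?n * (int (r 5) + 3)
      \<le> 4 * closed_corners 1 1 + 2 * (\<Sum>k\<in>{2, 3, 4, 5}. closed_corners 1 k)
        + (\<Sum>k\<in>{2, 3, 4, 5}. triangles 1 1 k)"
    using flip_inequality[of 2] flip_inequality[of 3] flip_inequality[of 4] flip_inequality[of 5] assms(2)
    by (simp add: iv algebra_simps)
  also have "\<dots> \<le> 5 * closed_corners 1 1 + 2 * (\<Sum>k\<in>{2, 3, 4, 5}. closed_corners 1 k)"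
    using triangles_nonneg[of 1 1 1] by (simp add: closed_corners_def iv)
  also have "\<dots> \<le> 2 * ?n * (int (r 2) + int (r 3) + int (r 4) + int (r 5))"
    using closed_corners_le[of 1 2] closed_corners_le[of 1 3] closed_corners_le[of 1 4]
      closed_corners_le[of 1 5] c11 assms(2)
    by (simp add: algebra_simps)
  \<comment> \<open>The degree terms agree on both sides; the contradiction comes from the surplus 0
    + 1 + 2 + 3 due to strictness of the flip conditions.\<close>
  finally show False
    using card_vertices_pos by (simp add: algebra_simps)
qed

text \<open>Constructions can thus be given as a color function on any finite vertex type; a
  bijection \<open>h\<close> numbers the vertices. The link is counted in ordered pairs, whence
  \<open>2 * c i\<close>.\<close>

lemma flip_sequenceI:
  fixes V :: "'v set" and f :: "'v \<Rightarrow> 'v \<Rightarrow> nat" and a :: "nat list" and c :: "nat \<Rightarrow> nat"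
  assumes V: "finite V" "V \<noteq> {}"
    and sym: "\<And>u v. u \<in> V \<Longrightarrow> v \<in> V \<Longrightarrow> f u v = f v u"
    and irrefl: "\<And>v. v \<in> V \<Longrightarrow> f v v = 0"
    and le: "\<And>u v. u \<in> V \<Longrightarrow> v \<in> V \<Longrightarrow> f u v \<le> length a"
    and degree: "\<And>v i. v \<in> V \<Longrightarrow> 1 \<le> i \<Longrightarrow> i \<le> length a \<Longrightarrow> card {u\<in>V. f v u = i} = a ! (i - 1)"
    and link: "\<And>v i. v \<in> V \<Longrightarrow> 1 \<le> i \<Longrightarrow> i \<le> length a \<Longrightarrow>
      card {(u, w). u \<in> V \<and> w \<in> V \<and> f v u \<noteq> 0 \<and> f v w \<noteq> 0 \<and> f u w = i} = 2 * c i"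
    and incr: "\<And>i j. 1 \<le> i \<Longrightarrow> i < j \<Longrightarrow> j \<le> length a \<Longrightarrow> a ! (i - 1) < a ! (j - 1)"
    and decr: "\<And>i j. 1 \<le> i \<Longrightarrow> i < j \<Longrightarrow> j \<le> length a \<Longrightarrow>
      a ! (i - 1) + c i > a ! (j - 1) + c j"
  shows "flip_sequence a"
proof -
  obtain h where h: "bij_betw h V {0..<card V}"
    using ex_bij_betw_finite_nat[OF V(1)] by blast
  then have inj: "inj_on h V"
    by (simp add: bij_betw_def)
  define g where "g = inv_into V h"
  have g [simp]: "g (h v) = v" if "v \<in> V" for v
    using that inj by (simp add: g_def)
  have h_eq [simp]: "h u = h v \<longleftrightarrow> u = v" if "u \<in> V" "v \<in> V" for u v
    using that inj by (auto simp: inj_on_def)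
  define E where "E = {{h u, h v} | u v. u \<in> V \<and> v \<in> V \<and> f u v \<noteq> 0}"
  \<comment> \<open>Minimum and maximum recover the endpoints of an unordered edge; by symmetry of
    \<open>f\<close> their order does not matter.\<close>
  define col where "col e = f (g (Min e)) (g (Max e))" for e
  have col: "col {h u, h v} = f u v" if "u \<in> V" "v \<in> V" for u v
    using that sym[of u v] by (cases "h u \<le> h v") (simp_all add: col_def)
  have memE: "{h u, h v} \<in> E \<longleftrightarrow> f u v \<noteq> 0" if "u \<in> V" "v \<in> V" for u v
    using that sym[of u v] by (auto simp: E_def doubleton_eq_iff)
  interpret G: edge_colored_graph "length a" "h ` V" E col
  proof
    show "h ` V \<noteq> {}"
      using V by simp
    show "e \<subseteq> h ` V \<and> card e = 2" if "e \<in> E" for e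
      using that irrefl by (fastforce simp: E_def card_2_iff)
    show "col e \<in> {1..length a}" if e: "e \<in> E" for e
    proof -
      obtain u v where "e = {h u, h v}" "u \<in> V" "v \<in> V" "f u v \<noteq> 0"
        using e unfolding E_def by blast
      then show ?thesis
        using col le by simp
    qed
  qed
  have ec: "G.ec (h u) (h v) = f u v" if "u \<in> V" "v \<in> V" for u v
    using that by (simp add: edge_color_def memE col)
  have "flip_graph (length a) (h ` V) E col (\<lambda>i. a ! (i - 1)) c"
  proof
    show "finite (h ` V)"
      using V by simp
  next
    fix v' i assume "v' \<in> h ` V" and i: "i \<in> {1..length a}"
    then obtain v where v: "v' = h v" "v \<in> V"
      by auto
    have "u \<in> h ` V" if "G.ec v' u = i" for u
      using that i G.ec_vertices[of v' u] by auto
    then have "{u. G.ec v' u = i} = {u\<in>h ` V. G.ec v' u = i}"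
      by blast
    also have "\<dots> = h ` {u\<in>V. f v u = i}"
      using v by (auto simp: ec)
    finally have "{u. G.ec v' u = i} = h ` {u\<in>V. f v u = i}" .
    moreover have "inj_on h {u\<in>V. f v u = i}"
      by (rule inj_on_subset[OF inj]) auto
    ultimately show "card (incident_edges E col i v') = a ! (i - 1)"
      using G.card_incident_edges[of i v'] i v degree by (simp add: card_image)
    let ?P = "{(u, w). u \<in> V \<and> w \<in> V \<and> f v u \<noteq> 0 \<and> f v w \<noteq> 0 \<and> f u w = i}"
    have "{(u, w). G.ec v' u \<noteq> 0 \<and> G.ec v' w \<noteq> 0 \<and> G.ec u w = i} = map_prod h h ` ?P" (is "?Q = _")
    proof (intro equalityI subsetI)
      fix p assume p: "p \<in> ?Q"
      then obtain u w where "p = (h u, h w)" "u \<in> V" "w \<in> V"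
        using G.ec_vertices by blast
      then show "p \<in> map_prod h h ` ?P"
        using p v by (auto simp: ec intro!: image_eqI[of _ _ "(u, w)"])
    qed (use v in \<open>auto simp: ec\<close>)
    moreover have "inj_on (map_prod h h) ?P"
      by (rule inj_on_subset[OF map_prod_inj_on[OF inj inj]]) auto
    ultimately show "card (induced_edges E col i (neighborhood E v')) = c i"
      using G.card_induced_edges[of i v'] i v V link by (simp add: card_image)
  qed (use incr decr in auto)
  then show ?thesis
    unfolding flip_sequence_def by blast
qed


section \<open>Blow-ups of bipartite graphs\<close>

text \<open>Adding \<open>i\<close> modulo \<open>n\<close> permutes the residues, with inverse
  adding \<open>n - i\<close>. Hence each residue class of base edges is a perfect matching: every
  base vertex meets it exactly once.\<close>

lemma card_shift_mod:
  fixes n i :: nat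
  assumes "i < n"
  shows "card {k. k < n \<and> P ((i + k) mod n)} = card {d. d < n \<and> P d}"
proof -
  have "bij_betw (\<lambda>k. (i + k) mod n) {k. k < n \<and> P ((i + k) mod n)} {d. d < n \<and> P d}"
  proof (rule bij_betw_byWitness[where f' = "\<lambda>d. (d + (n - i)) mod n"])
    show "\<forall>k\<in>{k. k < n \<and> P ((i + k) mod n)}. ((i + k) mod n + (n - i)) mod n = k"
    proof
      fix k assume "k \<in> {k. k < n \<and> P ((i + k) mod n)}"
      moreover have "i + k + (n - i) = k + n"
        using assms by simp
      ultimately show "((i + k) mod n + (n - i)) mod n = k"
        by (simp only: mod_add_left_eq) simp
    qed
    have shift: "(i + (d + (n - i)) mod n) mod n = d" if "d < n" for d
    proof -
      have "i + (d + (n - i)) = d + n"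
        using assms by simp
      then show ?thesis
        using that by (simp only: mod_add_right_eq) simp
    qed
    then show "\<forall>d\<in>{d. d < n \<and> P d}. (i + (d + (n - i)) mod n) mod n = d"
      by blast
    show "(\<lambda>d. (d + (n - i)) mod n) ` {d. d < n \<and> P d} \<subseteq> {k. k < n \<and> P ((i + k) mod n)}"
      using assms shift by auto
  qed (use assms in auto)
  then show ?thesis
    by (rule bij_betw_same_card)
qed

lemma card_off_diagonal: "finite A \<Longrightarrow> card {(x, y). x \<in> A \<and> y \<in> A \<and> x \<noteq> y} = card A * (card A - 1)"
proof -
  assume A: "finite A"
  have "{(x, y). x \<in> A \<and> y \<in> A \<and> x \<noteq> y} = (SIGMA x:A. A - {x})"
    by auto
  then show ?thesis
    using A by simp
qed

context
  fixes n L m :: nat and \<phi> :: "nat \<Rightarrow> nat"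
begin

text \<open>
  Vertex \<open>(s, i, x)\<close> is the \<open>x\<close>-th clique element over vertex \<open>i\<close> of side \<open>s\<close>. Base edges are classified
  by \<open>(i + i') mod n\<close>, a sum rather than a difference so that the rule is symmetric; the
  classes below \<open>L\<close> become full joins, the others matchings.
\<close>

definition blowup_color :: "bool \<times> nat \<times> nat \<Rightarrow> bool \<times> nat \<times> nat \<Rightarrow> nat" where
  "blowup_color = (\<lambda>(s, i, x) (s', i', x').
     if s = s' then of_bool (i = i' \<and> x \<noteq> x')
     else if (i + i') mod n < L \<or> x = x' then \<phi> ((i + i') mod n) else 0)"

definition blowup_vertices :: "(bool \<times> nat \<times> nat) set" where
  "blowup_vertices = UNIV \<times> {..<n} \<times> {..m}"

abbreviation "full j \<equiv> card {d. d < n \<and> d < L \<and> \<phi> d = j}"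
abbreviation "single j \<equiv> card {d. d < n \<and> \<not> d < L \<and> \<phi> d = j}"

context
  assumes L: "L \<le> n" and \<phi>: "\<And>d. d < n \<Longrightarrow> 2 \<le> \<phi> d"
begin

lemma blowup_degree_1:
  assumes "v \<in> blowup_vertices"
  shows "card {u\<in>blowup_vertices. blowup_color v u = 1} = m"
proof -
  obtain s i x where v: "v = (s, i, x)" "i < n" "x \<le> m"
    using assms by (auto simp: blowup_vertices_def)
  \<comment> \<open>Edges between the sides have color at least 2, so color 1 occurs only inside
    cliques.\<close>
  have [simp]: "0 < \<phi> (d mod n)" "\<phi> (d mod n) \<noteq> Suc 0" for d
    using \<phi>[of "d mod n"] v(2) by auto
  have "{u\<in>blowup_vertices. blowup_color v u = 1} = (\<lambda>x'. (s, i, x')) ` ({..m} - {x})"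
    using v
    by (auto simp: blowup_vertices_def blowup_color_def of_bool_def image_iff split: if_splits)
  then show ?thesis
    using v by (simp add: card_image inj_on_def)
qed

lemma blowup_degree:
  assumes "v \<in> blowup_vertices" "2 \<le> j"
  shows "card {u\<in>blowup_vertices. blowup_color v u = j} = (m + 1) * full j + single j"
proof -
  obtain s i x where v: "v = (s, i, x)" "i < n" "x \<le> m"
    using assms by (auto simp: blowup_vertices_def)
  let ?F = "{k. k < n \<and> (i + k) mod n < L \<and> \<phi> ((i + k) mod n) = j}"
  let ?S = "{k. k < n \<and> \<not> (i + k) mod n < L \<and> \<phi> ((i + k) mod n) = j}"
  \<comment> \<open>A full class contributes a whole clique, a matching class only the copy with the
    same index \<open>x\<close>.\<close>
  have "{u\<in>blowup_vertices. blowup_color v u = j} = Pair (\<not> s) ` (?F \<times> {..m} \<union> ?S \<times> {x})"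
    using v assms(2)
    by (auto simp: blowup_vertices_def blowup_color_def of_bool_def image_iff split: if_splits)
  then have "card {u\<in>blowup_vertices. blowup_color v u = j} = card (?F \<times> {..m} \<union> ?S \<times> {x})"
    by (simp add: card_image inj_on_def)
  also have "\<dots> = card (?F \<times> {..m}) + card (?S \<times> {x})"
    by (rule card_Un_disjoint) auto
  also have "\<dots> = (m + 1) * full j + single j"
    using card_shift_mod[OF v(2), of "\<lambda>d. d < L \<and> \<phi> d = j"]
      card_shift_mod[OF v(2), of "\<lambda>d. \<not> d < L \<and> \<phi> d = j"]
    by (simp add: card_cartesian_product)
  finally show ?thesis .
qed

text \<open>The own clique without \<open>v\<close> gives \<open>m * (m - 1)\<close> ordered pairs
  and each of the \<open>L\<close> fully joined cliques gives \<open>(m + 1) * m\<close>. A clique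
  reached by a matching holds a single neighbor and gives none.\<close>

lemma blowup_link_1:
  assumes "v \<in> blowup_vertices"
  shows "card {(u, w). u \<in> blowup_vertices \<and> w \<in> blowup_vertices \<and>
      blowup_color v u \<noteq> 0 \<and> blowup_color v w \<noteq> 0 \<and> blowup_color u w = 1}
    = m * (m - 1) + L * ((m + 1) * m)" (is "card ?P = _")
proof -
  obtain s i x where v: "v = (s, i, x)" "i < n" "x \<le> m"
    using assms by (auto simp: blowup_vertices_def)
  let ?F = "{k. k < n \<and> (i + k) mod n < L}"
  let ?D = "{(y, z). y \<in> {..m} - {x} \<and> z \<in> {..m} - {x} \<and> y \<noteq> z}"
  let ?D' = "{(y, z). y \<in> {..m} \<and> z \<in> {..m} \<and> y \<noteq> z}"
  let ?own = "(\<lambda>(y, z). ((s, i, y), (s, i, z))) ` ?D"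
  let ?other = "(\<lambda>(k, y, z). ((\<not> s, k, y), (\<not> s, k, z))) ` (?F \<times> ?D')"
  have fin: "finite ?D" "finite ?D'"
    by (rule finite_subset[of _ "{..m} \<times> {..m}"]; force)+
  have [simp]: "0 < \<phi> (d mod n)" "\<phi> (d mod n) \<noteq> Suc 0" for d
    using \<phi>[of "d mod n"] v(2) by auto
  have "(p \<in> ?P) = (p \<in> ?own \<union> ?other)" for p
  proof -
    obtain a k y b l z where p: "p = ((a, k, y), (b, l, z))"
      by (metis surj_pair)
    show ?thesis
      unfolding p using v
      by (cases s; cases a; cases b)
        (auto simp: blowup_vertices_def blowup_color_def image_iff split: if_splits)
  qed
  then have "?P = ?own \<union> ?other"
    by blast
  moreover have "?own \<inter> ?other = {}"
    by auto
  ultimately have "card ?P = card ?own + card ?other"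
    using fin by (simp add: card_Un_disjoint)
  also have "card ?own = m * (m - 1)"
    using v card_off_diagonal[of "{..m} - {x}"]
    by (subst card_image) (auto simp: inj_on_def)
  also have "card ?other = card ?F * card ?D'"
    by (subst card_image) (auto simp: inj_on_def card_cartesian_product)
  also have "card ?D' = (m + 1) * m"
    using card_off_diagonal[of "{..m}"] by simp
  also have "card ?F = L"
  proof -
    have "{d. d < n \<and> d < L} = {..<L}"
      using L by auto
    then show ?thesis
      using card_shift_mod[OF v(2), of "\<lambda>d. d < L"] by simp
  qed
  finally show ?thesis .
qed

text \<open>An edge of color at least 2 in the link runs from one of the \<open>m\<close> other
  members of the own clique to a neighbor across. If that neighbor is reached by a matching, its
  only neighbor in the own clique is \<open>v\<close> itself; so only full joins count.\<close>

lemma blowup_link: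
  assumes "v \<in> blowup_vertices" "2 \<le> j"
  shows "card {(u, w). u \<in> blowup_vertices \<and> w \<in> blowup_vertices \<and>
      blowup_color v u \<noteq> 0 \<and> blowup_color v w \<noteq> 0 \<and> blowup_color u w = j}
    = 2 * (m * (m + 1) * full j)" (is "card ?P = _")
proof -
  obtain s i x where v: "v = (s, i, x)" "i < n" "x \<le> m"
    using assms by (auto simp: blowup_vertices_def)
  let ?F = "{k. k < n \<and> (i + k) mod n < L \<and> \<phi> ((i + k) mod n) = j}"
  let ?A = "(\<lambda>(y, k, z). ((s, i, y), (\<not> s, k, z))) ` (({..m} - {x}) \<times> ?F \<times> {..m})"
  let ?B = "prod.swap ` ?A"
  have [simp]: "0 < \<phi> (d mod n)" "\<phi> (d mod n) \<noteq> Suc 0" for d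
    using \<phi>[of "d mod n"] v(2) by auto
  have "(p \<in> ?P) = (p \<in> ?A \<union> ?B)" for p
  proof -
    obtain a k y b l z where p: "p = ((a, k, y), (b, l, z))"
      by (metis surj_pair)
    show ?thesis
      unfolding p using v assms(2)
      by (cases s; cases a; cases b)
        (auto simp: blowup_vertices_def blowup_color_def image_iff add.commute split: if_splits)
  qed
  then have "?P = ?A \<union> ?B"
    by blast
  moreover have "?A \<inter> ?B = {}" "finite ?A"
    by auto
  ultimately have "card ?P = card ?A + card ?B"
    by (simp only: card_Un_disjoint finite_imageI)
  also have "card ?B = card ?A"
    by (rule card_image) simp
  also have "card ?A = m * (full j * (m + 1))"
    using v card_shift_mod[OF v(2), of "\<lambda>d. d < L \<and> \<phi> d = j"]
    by (subst card_image) (auto simp: inj_on_def card_cartesian_product)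
  finally show ?thesis
    by (simp add: algebra_simps)
qed

end

end

section \<open>Choice of multiplicities and size estimates\<close>

lemma length_filter_concat_replicate:
  "distinct ks \<Longrightarrow> length (filter (\<lambda>x. x = j) (concat (map (\<lambda>k. replicate (a k) k) ks)))
    = (if j \<in> set ks then a j else 0)"
  by (induction ks) (auto simp: filter_replicate)

text \<open>List \<open>a j\<close> copies of each color \<open>j\<close>, then \<open>b j\<close>
  copies; \<open>\<phi>\<close> reads off the entry and \<open>L\<close> is where the second list
  begins.\<close>

lemma ex_prescribed_multiplicities:
  fixes a b :: "nat \<Rightarrow> nat" and J :: "nat set"
  assumes "finite J"
  obtains n L :: nat and \<phi> :: "nat \<Rightarrow> nat" where
    "L \<le> n" "L = (\<Sum>j\<in>J. a j)"
    "\<And>d. d < n \<Longrightarrow> \<phi> d \<in> J"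
    "\<And>j. j \<in> J \<Longrightarrow> card {d. d < n \<and> d < L \<and> \<phi> d = j} = a j"
    "\<And>j. j \<in> J \<Longrightarrow> card {d. d < n \<and> \<not> d < L \<and> \<phi> d = j} = b j"
proof -
  obtain ks where ks: "set ks = J" "distinct ks"
    using finite_distinct_list[OF assms] by blast
  define list where "list a = concat (map (\<lambda>k. replicate (a k) k) ks)" for a :: "nat \<Rightarrow> nat"
  have count: "card {d. d < length (list a) \<and> list a ! d = j} = a j" if "j \<in> J" for a j
    using length_filter_concat_replicate[OF ks(2), of j a] that ks(1)
    by (simp add: length_filter_conv_card list_def)
  have length: "length (list a) = (\<Sum>j\<in>J. a j)" for a
    using ks by (simp add: list_def length_concat comp_def sum_list_distinct_conv_sum_set)
  have set: "set (list a) \<subseteq> J" for a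
    using ks by (auto simp: list_def)
  let ?xs = "list a" and ?ys = "list b"
  show thesis
  proof (rule that[where L = "length ?xs" and n = "length (?xs @ ?ys)" and \<phi> = "(!) (?xs @ ?ys)"])
    show "(?xs @ ?ys) ! d \<in> J" if "d < length (?xs @ ?ys)" for d
      using nth_mem[OF that] set by fastforce
  next
    fix j assume "j \<in> J"
    have "{d. d < length (?xs @ ?ys) \<and> d < length ?xs \<and> (?xs @ ?ys) ! d = j}
        = {d. d < length ?xs \<and> ?xs ! d = j}"
      by (auto simp: nth_append)
    then show "card {d. d < length (?xs @ ?ys) \<and> d < length ?xs \<and> (?xs @ ?ys) ! d = j} = a j"
      using count \<open>j \<in> J\<close> by simp
    have "{d. d < length (?xs @ ?ys) \<and> \<not> d < length ?xs \<and> (?xs @ ?ys) ! d = j}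
        = (+) (length ?xs) ` {d. d < length ?ys \<and> ?ys ! d = j}"
      by (auto simp: nth_append image_iff not_less le_iff_add)
    then show "card {d. d < length (?xs @ ?ys) \<and> \<not> d < length ?xs \<and> (?xs @ ?ys) ! d = j} = b j"
      using count \<open>j \<in> J\<close> by (simp add: card_image)
  qed (use length in auto)
qed

text \<open>Compare coefficients of \<open>(m + 1) * N\<close>: \<open>2 * (m + 1)\<close> on the
  left against \<open>(t - 1) * m\<close> on the right. The spare unit, \<open>(m + 1) * N\<close>,
  absorbs the terms in \<open>t\<close>; the lower bound on \<open>N\<close> is chosen for
  this.\<close>

lemma blowup_parameters:
  fixes m t N L :: nat
  assumes "2 * (m + 1) < (t - 1) * m" "2 * (m + 2) * t \<le> N" "(t - 1) * N \<le> L"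
  shows "2 * ((m + 1) * (N + t) + t + m * (m + 1) * (N + t)) < L * ((m + 1) * m)"
proof -
  have "1 \<le> t"
    using assms(1) by (cases t) auto
  have "2 * ((m + 1) * (N + t) + t + m * (m + 1) * (N + t))
      = 2 * (m + 1) * (m + 1) * N + 2 * ((m + 1) * (m + 1) + 1) * t"
    by (simp add: algebra_simps)
  also have "2 * ((m + 1) * (m + 1) + 1) * t < (m + 1) * (2 * (m + 2) * t)"
  proof -
    have "1 \<le> m"
      using assms(1) by (cases m) auto
    then have "2 * ((m + 1) * (m + 1) + 1) < (m + 1) * (2 * (m + 2))"
      by (simp add: algebra_simps)
    then show ?thesis
      using \<open>1 \<le> t\<close> by (metis mult.assoc mult_less_mono1 less_eq_Suc_le One_nat_def)
  qed
  also have "(m + 1) * (2 * (m + 2) * t) \<le> (m + 1) * N"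
    using assms(2) by (rule mult_le_mono2)
  also have "2 * (m + 1) * (m + 1) * N + (m + 1) * N = (2 * (m + 1) + 1) * ((m + 1) * N)"
    by (simp add: algebra_simps)
  also have "\<dots> \<le> ((t - 1) * m) * ((m + 1) * N)"
    using assms(1) by (intro mult_le_mono1) simp
  also have "\<dots> = ((t - 1) * N) * ((m + 1) * m)"
    by (simp add: algebra_simps)
  also have "\<dots> \<le> L * ((m + 1) * m)"
    using assms(3) by (rule mult_le_mono1)
  finally show ?thesis
    by simp
qed

text \<open>\<open>N\<close> is free above its lower bound, so for fixed \<open>m\<close> and
  \<open>t\<close> the degrees of colors 2 to \<open>t\<close> become arbitrarily large.\<close>

lemma flip_sequence_blowup:
  fixes m t N :: nat
  assumes tm: "2 * (m + 1) < (t - 1) * m" and N: "2 * (m + 2) * t \<le> N"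
  shows "flip_sequence (m # map (\<lambda>j. (m + 1) * (N + t) + j) [2..<Suc t])" (is "flip_sequence ?r")
proof -
  have "1 \<le> m"
    using tm by (cases m) auto
  have "2 \<le> t"
  proof (rule ccontr)
    assume "\<not> 2 \<le> t"
    then have "t - 1 = 0"
      by simp
    then show False
      using tm by simp
  qed
  \<comment> \<open>\<open>a\<close> falls by 1 at each color, and \<open>b\<close> overcompensates to make the degrees rise by 1.\<close>
  define a where "a j = N + t - j" for j
  define b where "b j = (m + 2) * j" for j :: nat
  obtain n L \<phi> where nL: "L \<le> n" "L = (\<Sum>j\<in>{2..t}. a j)"
    and \<phi>: "\<And>d. d < n \<Longrightarrow> \<phi> d \<in> {2..t}"
    and full: "\<And>j. j \<in> {2..t} \<Longrightarrow> card {d. d < n \<and> d < L \<and> \<phi> d = j} = a j"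
    and single: "\<And>j. j \<in> {2..t} \<Longrightarrow> card {d. d < n \<and> \<not> d < L \<and> \<phi> d = j} = b j"
    by (rule ex_prescribed_multiplicities[of "{2..t}" a b]) (simp, rule that)
  have \<phi>2: "\<And>d. d < n \<Longrightarrow> 2 \<le> \<phi> d"
    using \<phi> by auto
  let ?V = "blowup_vertices n m" and ?f = "blowup_color n L \<phi>"
  \<comment> \<open>Half of the ordered-pair counts of the link; both summands for color 1 are even,
    so the division is exact.\<close>
  define c where "c i = (if i = 1 then (m * (m - 1) + L * ((m + 1) * m)) div 2 else m * (m + 1) * a i)" for i
  have "(t - 1) * N = (\<Sum>j\<in>{2..t}. N)"
    by simp
  also have "\<dots> \<le> L"
    unfolding nL(2) a_def by (rule sum_mono) auto
  finally have L: "(t - 1) * N \<le> L" .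
  have "0 < N"
    using N \<open>2 \<le> t\<close> by (cases N) auto
  then have "0 < n"
    using L nL(1) \<open>2 \<le> t\<close> by (cases n) auto
  have len: "length ?r = t"
    using \<open>2 \<le> t\<close> by simp
  have r1: "?r ! (1 - 1) = m"
    by simp
  have r: "?r ! (i - 1) = (m + 1) * (N + t) + i" if "2 \<le> i" "i \<le> t" for i
    using le_Suc_ex[OF that(1)] that(2) by (auto simp del: upt_Suc)
  have r': "(m + 1) * a i + b i = (m + 1) * (N + t) + i" if "i \<le> t" for i
    using le_Suc_ex[OF that] by (auto simp: a_def b_def algebra_simps)
  have one: "i = 1 \<or> 2 \<le> i" if "1 \<le> i" for i :: nat
    using that by auto
  have "even (m * (m - 1) + L * ((m + 1) * m))"
    by auto
  then have c1: "2 * c 1 = m * (m - 1) + L * ((m + 1) * m)"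
    by (simp add: c_def)
  show ?thesis
  proof (rule flip_sequenceI[where V = ?V and f = ?f and c = c], unfold len)
    show "finite ?V" "?V \<noteq> {}"
      using \<open>0 < n\<close> by (auto simp: blowup_vertices_def)
    show "?f u v = ?f v u" for u v
      by (auto simp: blowup_color_def add.commute split: prod.splits)
    show "?f v v = 0" for v
      by (auto simp: blowup_color_def split: prod.splits)
    show "?f u v \<le> t" for u v
      using \<phi>[of "_ mod n"] \<open>0 < n\<close> \<open>2 \<le> t\<close> by (auto simp: blowup_color_def split: prod.splits)
  next
    fix v i assume v: "v \<in> ?V" and i: "1 \<le> i" "i \<le> t"
    show "card {u\<in>?V. ?f v u = i} = ?r ! (i - 1)"
      using one[OF i(1)]
    proof
      assume "i = 1"
      then show ?thesis
        using blowup_degree_1[OF nL(1) \<phi>2 v] r1 by simp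
    next
      assume "2 \<le> i"
      then show ?thesis
        using blowup_degree[OF nL(1) \<phi>2 v, where j = i] full single r r' i by simp
    qed
    show "card {(u, w). u \<in> ?V \<and> w \<in> ?V \<and> ?f v u \<noteq> 0 \<and> ?f v w \<noteq> 0 \<and> ?f u w = i} = 2 * c i"
      using one[OF i(1)]
    proof
      assume "i = 1"
      then show ?thesis
        using blowup_link_1[OF nL(1) \<phi>2 v] c1 by simp
    next
      assume "2 \<le> i"
      then show ?thesis
        using blowup_link[OF nL(1) \<phi>2 v, where j = i] full i by (simp add: c_def)
    qed
  next
    fix i j assume ij: "1 \<le> i" "i < j" "j \<le> t"
    show "?r ! (i - 1) < ?r ! (j - 1)"
      using one[OF ij(1)]
    proof
      assume "i = 1"
      have "m < (m + 1) * 1 + j"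
        by simp
      also have "\<dots> \<le> (m + 1) * (N + t) + j"
        using \<open>0 < N\<close> by (intro add_right_mono mult_le_mono2) simp
      finally have "m < (m + 1) * (N + t) + j" .
      moreover have "?r ! (j - 1) = (m + 1) * (N + t) + j"
        using ij by (intro r) auto
      ultimately show ?thesis
        using \<open>i = 1\<close> r1 by (simp del: upt_Suc)
    next
      assume "2 \<le> i"
      then show ?thesis
        using r[of i] r[of j] ij by simp
    qed
    show "?r ! (j - 1) + c j < ?r ! (i - 1) + c i"
      using one[OF ij(1)]
    proof
      assume i: "i = 1"
      \<comment> \<open>Replacing \<open>j\<close> by \<open>t\<close> and \<open>a j\<close> by
        \<open>N + t\<close> gives one bound for all colors.\<close>
      have "2 * ((m + 1) * (N + t) + j + m * (m + 1) * a j)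
          \<le> 2 * ((m + 1) * (N + t) + t + m * (m + 1) * (N + t))"
        using ij by (intro mult_le_mono2 add_mono) (auto simp: a_def)
      also have "\<dots> < L * ((m + 1) * m)"
        using tm N L by (rule blowup_parameters)
      also have "\<dots> \<le> 2 * c 1"
        unfolding c1 by simp
      finally have "(m + 1) * (N + t) + j + c j < m + c 1"
        using ij by (simp add: c_def)
      moreover have "?r ! (j - 1) = (m + 1) * (N + t) + j"
        using ij by (intro r) auto
      ultimately show ?thesis
        using i r1 by (simp del: upt_Suc)
    next
      assume i: "2 \<le> i"
      \<comment> \<open>From color \<open>i\<close> to \<open>j\<close> the degree rises by
        \<open>j - i\<close>, while \<open>c\<close> falls by \<open>m * (m + 1) * (j - i)\<close>,
        at least twice as much.\<close>
      have aij: "a i = a j + (j - i)"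
        using ij by (simp add: a_def)
      have "2 * 1 \<le> (m + 1) * m"
        using \<open>1 \<le> m\<close> by (intro mult_le_mono) auto
      then have "2 * (j - i) \<le> m * (m + 1) * (j - i)"
        by (intro mult_le_mono1) (simp add: mult.commute)
      then have "j + m * (m + 1) * a j < i + m * (m + 1) * a i"
        unfolding aij add_mult_distrib2 using ij by linarith
      moreover have "?r ! (i - 1) = (m + 1) * (N + t) + i" "?r ! (j - 1) = (m + 1) * (N + t) + j"
        using i ij by (intro r; simp)+
      ultimately show ?thesis
        using i ij by (simp add: c_def del: upt_Suc)
    qed
  qed
qed

theorem theorem5p8:
  shows "((\<forall>B::nat. \<exists>a2 a3 a4. flip_sequence [3, a2, a3, a4] \<and> a4 > B) \<and>
          (\<exists>B4::nat. \<forall>a1 a2 a3 a4. flip_sequence [a1, a2, a3, a4] \<and> a1 \<le> 2 \<longrightarrow> a4 \<le> B4))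
       \<and> ((\<forall>B::nat. \<exists>a2 a3 a4 a5. flip_sequence [2, a2, a3, a4, a5] \<and> a5 > B) \<and>
          (\<exists>B5::nat. \<forall>a2 a3 a4 a5. flip_sequence [1, a2, a3, a4, a5] \<longrightarrow> a5 \<le> B5))
       \<and> (\<forall>B::nat. \<exists>a2 a3 a4 a5 a6. flip_sequence [1, a2, a3, a4, a5, a6] \<and> a6 > B)"
proof (intro conjI allI)
  fix B :: nat
  \<comment> \<open>This is \<open>(m + 1) * (N + t)\<close> with
    \<open>N = B + 2 * (m + 2) * t\<close>, which meets the lower bound on \<open>N\<close> and
    pushes the last degree beyond \<open>B\<close>.\<close>
  let ?K = "\<lambda>m t. (m + 1) * (B + 2 * (m + 2) * t + t)"
  have "flip_sequence (3 # map (\<lambda>j. ?K 3 4 + j) [2..<Suc 4])"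
    by (rule flip_sequence_blowup) auto
  also have "map (\<lambda>j. ?K 3 4 + j) [2..<Suc 4] = [?K 3 4 + 2, ?K 3 4 + 3, ?K 3 4 + 4]"
    by (simp add: upt_rec)
  finally show "\<exists>a2 a3 a4. flip_sequence [3, a2, a3, a4] \<and> a4 > B"
    by (intro exI conjI) (assumption, simp)
  have "flip_sequence (2 # map (\<lambda>j. ?K 2 5 + j) [2..<Suc 5])"
    by (rule flip_sequence_blowup) auto
  also have "map (\<lambda>j. ?K 2 5 + j) [2..<Suc 5] = [?K 2 5 + 2, ?K 2 5 + 3, ?K 2 5 + 4, ?K 2 5 + 5]"
    by (simp add: upt_rec)
  finally show "\<exists>a2 a3 a4 a5. flip_sequence [2, a2, a3, a4, a5] \<and> a5 > B"
    by (intro exI conjI) (assumption, simp)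
  have "flip_sequence (1 # map (\<lambda>j. ?K 1 6 + j) [2..<Suc 6])"
    by (rule flip_sequence_blowup) auto
  also have "map (\<lambda>j. ?K 1 6 + j) [2..<Suc 6]
      = [?K 1 6 + 2, ?K 1 6 + 3, ?K 1 6 + 4, ?K 1 6 + 5, ?K 1 6 + 6]"
    by (simp add: upt_rec)
  finally show "\<exists>a2 a3 a4 a5 a6. flip_sequence [1, a2, a3, a4, a5, a6] \<and> a6 > B"
    by (intro exI conjI) (assumption, simp)
next
  have "\<not> flip_sequence [a1, a2, a3, a4]" if "a1 \<le> 2" for a1 a2 a3 a4
  proof
    have len: "length [a1, a2, a3, a4] = 4"
      by simp
    assume "flip_sequence [a1, a2, a3, a4]"
    then obtain c E col and V :: "nat set" where "flip_graph 4 V E col (\<lambda>i. [a1, a2, a3, a4] ! (i - 1)) c"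
      unfolding flip_sequence_def len by blast
    then show False
      by (rule no_flip_graph_4) (use that in simp)
  qed
  \<comment> \<open>The bound is vacuous, so any constant serves.\<close>
  then show "\<exists>B4::nat. \<forall>a1 a2 a3 a4. flip_sequence [a1, a2, a3, a4] \<and> a1 \<le> 2 \<longrightarrow> a4 \<le> B4"
    by blast
  have "\<not> flip_sequence [1, a2, a3, a4, a5]" for a2 a3 a4 a5
  proof
    have len: "length [1, a2, a3, a4, a5] = 5"
      by simp
    assume "flip_sequence [1, a2, a3, a4, a5]"
    then obtain c E col and V :: "nat set" where "flip_graph 5 V E col (\<lambda>i. [1, a2, a3, a4, a5] ! (i - 1)) c"
      unfolding flip_sequence_def len by blast
    then show False
      by (rule no_flip_graph_5) simp
  qed
  then show "\<exists>B5::nat. \<forall>a2 a3 a4 a5. flip_sequence [1, a2, a3, a4, a5] \<longrightarrow> a5 \<le> B5"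
    by blast
qed

end
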